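(* For each positive integer $k$, let $G_k$ be the graph with vertex set $[k]\cup\binom{[k]}{2}$, where $[k]=\{1,\dots,k\}$ and $\binom{[k]}{2}$ is the set of unordered pairs $\{i,j\}$ of distinct elements of $[k]$, and in which each vertex $\{i,j\}\in\binom{[k]}{2}$ is adjacent exactly to the vertices $i$ and $j$ of $[k]$ (there are no other edges). Then the number of potential maximal cliques of $G_k$ is $\Omega(4^k)$, i.e., there is a constant $c>0$ such that $G_k$ has at least $c\cdot 4^k$ potential maximal cliques for all $k\ge 1$.
   Context: Note that $[k]$ is a vertex cover of $G_k$ of size $k$ and $G_k$ has $k+\binom{k}{2}=O(k^2)$ vertices. A triangulation of a graph $G$ is a chordal graph $H$ with $V(H)=V(G)$ and $E(G)\subseteq E(H)$; it is minimal if no triangulation of $G$ has an edge set that is a proper subset of $E(H)$. A set $\Omega\subseteq V(G)$ is a potential maximal clique (PMC) of $G$ if $\Omega$ is a maximal clique of some minimal triangulation of $G$. *)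

theory Defs
  imports Complex_Main "HOL-Library.Ramsey"
begin

text \<open>A graph is given by its vertex set \<open>V\<close> and its set \<open>E\<close> of edges, which are two-element
  subsets of \<open>V\<close>.\<close>

definition simple_graph :: "'a set \<Rightarrow> 'a set set \<Rightarrow> bool" where
  "simple_graph V E \<longleftrightarrow> finite V \<and> E \<subseteq> [V]\<^bsup>2\<^esup>"

definition cycle_edges :: "'a list \<Rightarrow> 'a set set" where
  "cycle_edges xs = {{xs ! i, xs ! (Suc i mod length xs)} | i. i < length xs}"

definition is_cycle :: "'a set set \<Rightarrow> 'a list \<Rightarrow> bool" where
  "is_cycle E xs \<longleftrightarrow> length xs \<ge> 3 \<and> distinct xs \<and> cycle_edges xs \<subseteq> E"

definition has_chord :: "'a set set \<Rightarrow> 'a list \<Rightarrow> bool" where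
  "has_chord E xs \<longleftrightarrow> (\<exists>e\<in>E. e \<subseteq> set xs \<and> e \<notin> cycle_edges xs)"

definition chordal :: "'a set \<Rightarrow> 'a set set \<Rightarrow> bool" where
  "chordal V E \<longleftrightarrow> simple_graph V E \<and>
     (\<forall>xs. is_cycle E xs \<and> length xs \<ge> 4 \<longrightarrow> has_chord E xs)"

text \<open>As a triangulation of \<open>(V, E)\<close> has the same vertex set, it is given by its edge set \<open>F\<close>.\<close>

definition triangulation :: "'a set \<Rightarrow> 'a set set \<Rightarrow> 'a set set \<Rightarrow> bool" where
  "triangulation V E F \<longleftrightarrow> chordal V F \<and> E \<subseteq> F"

definition minimal_triangulation :: "'a set \<Rightarrow> 'a set set \<Rightarrow> 'a set set \<Rightarrow> bool" where
  "minimal_triangulation V E F \<longleftrightarrow>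
     triangulation V E F \<and> \<not> (\<exists>F'. triangulation V E F' \<and> F' \<subset> F)"

definition maximal_clique :: "'a set \<Rightarrow> 'a set set \<Rightarrow> 'a set \<Rightarrow> bool" where
  "maximal_clique V E K \<longleftrightarrow>
     K \<subseteq> V \<and> clique K E \<and> \<not> (\<exists>K'. K' \<subseteq> V \<and> clique K' E \<and> K \<subset> K')"

definition pmc :: "'a set \<Rightarrow> 'a set set \<Rightarrow> 'a set \<Rightarrow> bool" where
  "pmc V E K \<longleftrightarrow> (\<exists>F. minimal_triangulation V E F \<and> maximal_clique V F K)"

text \<open>In \<open>G\<^sub>k\<close>, the vertex \<open>i \<in> [k]\<close> is \<open>Inl i\<close> and the vertex \<open>{i, j}\<close> is \<open>Inr {i, j}\<close>.\<close>

definition G_verts :: "nat \<Rightarrow> (nat + nat set) set" where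
  "G_verts k = Inl ` {1..k} \<union> Inr ` [{1..k}]\<^bsup>2\<^esup>"

definition G_edges :: "nat \<Rightarrow> (nat + nat set) set set" where
  "G_edges k = {{Inr p, Inl i} | p i. p \<in> [{1..k}]\<^bsup>2\<^esup> \<and> i \<in> p}"

lemma simple_graph_G: "simple_graph (G_verts k) (G_edges k)"
  by (auto simp: simple_graph_def G_verts_def G_edges_def finite_imp_finite_nsets)
     (auto simp: nsets_def)

lemma card_G_verts: "card (G_verts k) = k + (k choose 2)"
  unfolding G_verts_def
  by (subst card_Un_disjoint)
     (auto simp: finite_imp_finite_nsets card_image card_nsets)

lemma finite_pmcs: "finite V \<Longrightarrow> finite {K. pmc V E K}"
  by (rule finite_subset[of _ "Pow V"]) (auto simp: pmc_def maximal_clique_def)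

end

theory Submission
  imports Defs
begin

text \<open>Colour \<open>[k]\<close> with \<open>0, 1, 2, 3\<close>, using each of \<open>1, 2, 3\<close>. Let \<open>K\<close> consist of the vertices of
  colour \<open>0\<close> and the pairs whose ends have two different nonzero colours. Deleting \<open>K\<close> leaves one
  component for each nonzero colour \<open>a\<close> (and isolated pairs); its neighbourhood \<open>N\<^sub>a\<close> is a minimal
  separator that misses some pair in \<open>K\<close>, and any two vertices of \<open>K\<close> lie in a common \<open>N\<^sub>a\<close>
  because two 2-subsets of \<open>{1, 2, 3}\<close> meet. Completing \<open>K\<close> and every component together with its
  neighbourhood gives a triangulation in which each \<open>N\<^sub>a\<close> still separates. So in every
  triangulation below it, in particular in a minimal one, every \<open>N\<^sub>a\<close> is a clique; hence so is
  \<open>K\<close>, and \<open>K\<close> is a maximal clique. If the colours of \<open>1, 2, 3\<close> are fixed as \<open>1, 2, 3\<close>, then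
  \<open>K\<close> determines the colouring, which gives \<open>4 ^ (k - 3)\<close> potential maximal cliques.\<close>

section \<open>Walks and cycles\<close>

fun walk_edges :: "'a list \<Rightarrow> 'a set set" where
  "walk_edges (x # y # zs) = insert {x, y} (walk_edges (y # zs))"
| "walk_edges _ = {}"

lemma walk_edges_append:
  "walk_edges (xs @ y # zs) = walk_edges (xs @ [y]) \<union> walk_edges (y # zs)"
  by (induction xs rule: walk_edges.induct) auto

lemma walk_edges_rev: "walk_edges (rev xs) = walk_edges xs"
proof (induction xs rule: walk_edges.induct)
  case (1 x y zs)
  then show ?case
    using walk_edges_append[of "rev zs" y "[x]"] by (auto simp: insert_commute)
qed auto

lemma walk_edges_nth: "walk_edges xs = {{xs ! i, xs ! Suc i} | i. Suc i < length xs}"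
proof (induction xs rule: walk_edges.induct)
  case (1 x y zs)
  have "{{(x # y # zs) ! i, (x # y # zs) ! Suc i} | i. Suc i < length (x # y # zs)} =
    insert {x, y} {{(y # zs) ! i, (y # zs) ! Suc i} | i. Suc i < length (y # zs)}" (is "?L = ?R")
  proof
    show "?L \<subseteq> ?R"
    proof
      fix e assume "e \<in> ?L"
      then obtain i where "e = {(x # y # zs) ! i, (x # y # zs) ! Suc i}" "Suc i < length (x # y # zs)"
        by blast
      then show "e \<in> ?R" by (cases i) auto
    qed
    show "?R \<subseteq> ?L"
    proof
      fix e assume "e \<in> ?R"
      then consider "e = {x, y}"
        | i where "e = {(y # zs) ! i, (y # zs) ! Suc i}" "Suc i < length (y # zs)" by blast
      then show "e \<in> ?L"
      proof cases
        case 1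
        then show ?thesis by (intro CollectI exI[of _ 0]) auto
      next
        case (2 i)
        then show ?thesis by (intro CollectI exI[of _ "Suc i"]) auto
      qed
    qed
  qed
  with 1 show ?case by simp
qed auto

text \<open>Repeating the first vertex at the end replaces the wrap-around index, so that cycles can
  be cut into walks with \<open>walk_edges_append\<close>.\<close>

lemma cycle_edges_eq_walk_edges: "cycle_edges (x # xs) = walk_edges (x # xs @ [x])"
proof -
  have "{(x # xs) ! i, (x # xs) ! (Suc i mod length (x # xs))} =
      {(x # xs @ [x]) ! i, (x # xs @ [x]) ! Suc i}" if "i < length (x # xs)" for i
  proof (cases "Suc i = length (x # xs)")
    case True
    then show ?thesis by (cases xs rule: rev_cases) (auto simp: nth_append nth_Cons split: nat.splits)
  next
    case False
    with that show ?thesis by (auto simp: nth_append nth_Cons split: nat.splits)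
  qed
  then show ?thesis
    unfolding cycle_edges_def walk_edges_nth by (auto intro!: Collect_cong)
qed

definition walk :: "'a set set \<Rightarrow> 'a set \<Rightarrow> 'a \<Rightarrow> 'a \<Rightarrow> 'a list \<Rightarrow> bool" where
  "walk E U u v w \<longleftrightarrow> w \<noteq> [] \<and> hd w = u \<and> last w = v \<and> set w \<subseteq> U \<and> walk_edges w \<subseteq> E"

lemma walk_rev: "walk E U u v w \<Longrightarrow> walk E U v u (rev w)"
  by (auto simp: walk_def walk_edges_rev hd_rev last_rev)

lemma walk_trans:
  assumes "walk E U u v w" "walk E U v z w'"
  shows "walk E U u z (w @ tl w')"
proof -
  obtain xs where w: "w = xs @ [v]"
    using assms(1) unfolding walk_def by (metis append_butlast_last_id)
  obtain ys where w': "w' = v # ys"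
    using assms(2) unfolding walk_def by (metis list.collapse)
  show ?thesis
    using assms unfolding w w' walk_def
    by (auto simp: hd_append walk_edges_append[of xs v ys] split: if_splits)
qed

lemma walk_mono: "walk E U u v w \<Longrightarrow> E \<subseteq> E' \<Longrightarrow> walk E' U u v w"
  by (auto simp: walk_def)

text \<open>A shortest walk is induced: a repeated vertex or an edge between non-consecutive
  vertices would give a shorter one.\<close>

lemma induced_walk_exists:
  assumes "walk E U u v w0"
  obtains w where "walk E U u v w" "distinct w"
    "\<And>x y. x \<in> set w \<Longrightarrow> y \<in> set w \<Longrightarrow> x \<noteq> y \<Longrightarrow> {x, y} \<in> E \<Longrightarrow> {x, y} \<in> walk_edges w"
proof -
  obtain w where w: "walk E U u v w" and min: "\<And>w'. walk E U u v w' \<Longrightarrow> length w \<le> length w'"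
    using ex_has_least_nat[of "walk E U u v" w0 length] assms by blast
  have "distinct w"
  proof (rule ccontr)
    assume "\<not> distinct w"
    then obtain xs ys zs y where ws: "w = xs @ [y] @ ys @ [y] @ zs"
      using not_distinct_decomp by blast
    have "walk E U u v (xs @ [y] @ zs)"
      using w walk_edges_append[of xs y "ys @ [y] @ zs"] walk_edges_append[of "y # ys" y zs]
        walk_edges_append[of xs y zs]
      unfolding ws walk_def by (auto simp: hd_append split: if_splits)
    from min[OF this] show False by (simp add: ws)
  qed
  \<comment> \<open>Here \<open>x\<close> precedes \<open>y\<close>; unless they are consecutive,
    the edge bypasses \<open>ys\<close> and shortens the walk.\<close>
  moreover have ordered: "{x, y} \<in> walk_edges w"
    if e: "{x, y} \<in> E" and ws: "w = xs @ x # ys @ y # zs" for x y xs ys zs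
  proof (cases "ys = []")
    case True
    then show ?thesis
      using walk_edges_append[of xs x "y # zs"] by (simp add: ws)
  next
    case False
    have "walk E U u v (xs @ x # y # zs)"
      using w e walk_edges_append[of xs x "ys @ [y] @ zs"] walk_edges_append[of "x # ys" y zs]
        walk_edges_append[of xs x "y # zs"]
      unfolding ws walk_def by (auto simp: hd_append split: if_splits)
    from min[OF this] False show ?thesis by (simp add: ws)
  qed
  moreover have "{x, y} \<in> walk_edges w"
    if x: "x \<in> set w" and y: "y \<in> set w" and ne: "x \<noteq> y" and e: "{x, y} \<in> E" for x y
  proof -
    obtain xs ys where ws: "w = xs @ x # ys" using x by (meson split_list)
    consider "y \<in> set xs" | "y \<in> set ys" using y ne unfolding ws by auto
    then show ?thesis
    proof cases
      case 1
      then obtain as bs where "xs = as @ y # bs" by (meson split_list)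
      with ordered[of y x as bs ys] e ws show ?thesis by (simp add: insert_commute)
    next
      case 2
      then obtain as bs where "ys = as @ y # bs" by (meson split_list)
      with ordered[of x y xs as bs] e ws show ?thesis by simp
    qed
  qed
  ultimately show ?thesis using w that by blast
qed

text \<open>A shortest walk through \<open>A\<close> and one through \<open>B\<close> form a cycle whose only possible chord
  is \<open>{u, v}\<close>.\<close>

lemma chordal_edge_if_separated:
  assumes ch: "chordal V F" and uv: "u \<noteq> v" "u \<notin> A \<union> B" "v \<notin> A \<union> B" and AB: "A \<inter> B = {}"
    and wA: "walk F (insert u (insert v A)) u v wA"
    and wB: "walk F (insert u (insert v B)) v u wB"
    and sep: "\<And>a b. a \<in> A \<Longrightarrow> b \<in> B \<Longrightarrow> {a, b} \<notin> F"
  shows "{u, v} \<in> F"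
proof (rule ccontr)
  assume nuv: "{u, v} \<notin> F"
  \<comment> \<open>As \<open>{u, v}\<close> is not an edge, such a walk has an inner vertex, and by
    distinctness its inner vertices avoid \<open>u\<close> and \<open>v\<close>.\<close>
  have decomp: "\<exists>P. w = x # P @ [y] \<and> P \<noteq> [] \<and> set P \<subseteq> U"
    if "walk F (insert u (insert v U)) x y w" "distinct w" "{x, y} = {u, v}" for w x y U
  proof -
    have "x \<noteq> y" using that(3) uv(1) by auto
    with that(1) obtain zs where zs: "w = x # zs" "zs \<noteq> []"
      unfolding walk_def by (cases w) (auto split: if_splits)
    with that(1) obtain P where P: "zs = P @ [y]"
      unfolding walk_def by (cases zs rule: rev_cases) auto
    have "P \<noteq> []" using that(1,3) nuv unfolding zs P walk_def by auto
    moreover have "set P \<subseteq> U"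
      using that unfolding zs P walk_def by (auto simp: doubleton_eq_iff)
    ultimately show ?thesis using zs P by auto
  qed
  obtain w1 where w1: "walk F (insert u (insert v A)) u v w1" "distinct w1"
    and ind1: "\<And>x y. x \<in> set w1 \<Longrightarrow> y \<in> set w1 \<Longrightarrow> x \<noteq> y \<Longrightarrow> {x, y} \<in> F \<Longrightarrow> {x, y} \<in> walk_edges w1"
    using induced_walk_exists[OF wA] by blast
  obtain w2 where w2: "walk F (insert u (insert v B)) v u w2" "distinct w2"
    and ind2: "\<And>x y. x \<in> set w2 \<Longrightarrow> y \<in> set w2 \<Longrightarrow> x \<noteq> y \<Longrightarrow> {x, y} \<in> F \<Longrightarrow> {x, y} \<in> walk_edges w2"
    using induced_walk_exists[OF wB] by blast
  obtain P where P: "w1 = u # P @ [v]" "P \<noteq> []" "set P \<subseteq> A" using decomp[OF w1] by blast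
  obtain Q where Q: "w2 = v # Q @ [u]" "Q \<noteq> []" "set Q \<subseteq> B" using decomp[OF w2] by blast
  define xs where "xs = u # P @ v # Q"
  have ce: "cycle_edges xs = walk_edges w1 \<union> walk_edges w2"
    unfolding xs_def cycle_edges_eq_walk_edges P(1) Q(1)
    using walk_edges_append[of "u # P" v "Q @ [u]"] by simp
  have "is_cycle F xs"
    using w1 w2 AB uv P Q unfolding is_cycle_def ce
    by (auto simp: walk_def xs_def Suc_le_eq)
  moreover have "length xs \<ge> 4"
    using P(2) Q(2) by (cases P; cases Q) (auto simp: xs_def)
  ultimately obtain e where e: "e \<in> F" "e \<subseteq> set xs" "e \<notin> cycle_edges xs"
    using ch unfolding chordal_def has_chord_def by blast
  have "e \<in> [V]\<^bsup>2\<^esup>" using ch e(1) unfolding chordal_def simple_graph_def by blast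
  then obtain x y where xy: "e = {x, y}" "x \<noteq> y"
    by (auto simp: nsets_def card_2_iff)
  have xyF: "{x, y} \<in> F" "{y, x} \<in> F" using e(1) xy(1) by (auto simp: insert_commute)
  \<comment> \<open>Both walks are induced and all their edges are cycle edges, so a chord cannot
    have both ends on the same walk. It thus joins \<open>A\<close> to \<open>B\<close>.\<close>
  have "\<not> (x \<in> set w1 \<and> y \<in> set w1)" "\<not> (x \<in> set w2 \<and> y \<in> set w2)"
    using ind1[of x y] ind2[of x y] e xy ce by auto
  moreover have "x \<in> set xs" "y \<in> set xs" using e(2) xy by auto
  ultimately have "x \<in> A \<and> y \<in> B \<or> x \<in> B \<and> y \<in> A"
    using P Q unfolding xs_def by auto
  then show False using sep xyF by blast
qed

section \<open>Triangulations\<close>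

text \<open>If a cycle leaves \<open>K\<close>, the two cycle neighbours of a vertex outside
  \<open>K\<close> are adjacent; otherwise the whole cycle lies in \<open>K\<close>. In both cases
  two vertices two steps apart on the cycle give a chord.\<close>

lemma chordal_if_simplicial_outside_clique:
  assumes sg: "simple_graph V E" and K: "clique K E"
    and simp: "\<And>x. x \<in> V \<Longrightarrow> x \<notin> K \<Longrightarrow> clique {y. {x, y} \<in> E} E"
  shows "chordal V E"
  unfolding chordal_def
proof (intro conjI sg allI impI)
  fix xs :: "'a list"
  assume cyc: "is_cycle E xs \<and> 4 \<le> length xs"
  define n where "n = length xs"
  have n: "n \<ge> 4" and dist: "distinct xs" using cyc by (auto simp: n_def is_cycle_def)
  have edge: "{xs ! i, xs ! (Suc i mod n)} \<in> E" if "i < n" for i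
    using cyc that unfolding is_cycle_def cycle_edges_def n_def by auto
  have smod: "Suc i mod n = (if Suc i = n then 0 else Suc i)" if "i < n" for i
    using that by auto
  \<comment> \<open>\<open>m\<close> is the position of a cycle vertex outside \<open>K\<close>; the
    default 0 serves when the cycle lies inside \<open>K\<close>.\<close>
  define m where "m = (if \<exists>m<n. xs ! m \<notin> K then SOME m. m < n \<and> xs ! m \<notin> K else 0)"
  have m: "m < n" "xs ! m \<notin> K \<or> set xs \<subseteq> K"
    using someI_ex[of "\<lambda>m. m < n \<and> xs ! m \<notin> K"] n unfolding m_def
    by (auto simp: in_set_conv_nth n_def)
  \<comment> \<open>\<open>a\<close> and \<open>b\<close> are the cyclic predecessor and successor
    positions of \<open>m\<close>.\<close>
  define a where "a = (if m = 0 then n - 1 else m - 1)"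
  define b where "b = (if Suc m = n then 0 else Suc m)"
  have an: "a < n" "Suc a mod n = m" and bn: "b < n" "Suc m mod n = b"
    using m(1) n by (auto simp: a_def b_def)
  have ab: "a \<noteq> b" using n m(1) by (auto simp: a_def b_def split: if_splits)
  have neq: "xs ! a \<noteq> xs ! b" using dist an bn ab by (simp add: n_def nth_eq_iff_index_eq)
  have "{xs ! a, xs ! b} \<in> E"
  proof (cases "set xs \<subseteq> K")
    case True
    then show ?thesis using K neq an bn unfolding clique_def n_def by (meson nth_mem subsetD)
  next
    case False
    then have "xs ! m \<notin> K" using m by blast
    moreover have am: "{xs ! m, xs ! a} \<in> E" using edge[OF an(1)] an(2) by (simp add: insert_commute)
    moreover have "{xs ! m, xs ! b} \<in> E" using edge[OF m(1)] bn(2) by simp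
    moreover have "xs ! m \<in> V" using am sg unfolding simple_graph_def nsets_def by blast
    ultimately show ?thesis using simp[of "xs ! m"] neq unfolding clique_def by blast
  qed
  moreover have "{xs ! a, xs ! b} \<notin> cycle_edges xs"
  proof
    assume "{xs ! a, xs ! b} \<in> cycle_edges xs"
    then obtain j where j: "j < n" "{xs ! a, xs ! b} = {xs ! j, xs ! (Suc j mod n)}"
      unfolding cycle_edges_def n_def by blast
    define j' where "j' = Suc j mod n"
    have j': "j' < n" "j' = (if Suc j = n then 0 else Suc j)"
      using smod[OF j(1)] j(1) n by (auto simp: j'_def)
    have "a = j \<and> b = j' \<or> a = j' \<and> b = j"
      using j(2) dist an(1) bn(1) j(1) j'(1) unfolding j'_def[symmetric]
      by (auto simp: doubleton_eq_iff n_def nth_eq_iff_index_eq)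
    \<comment> \<open>Positions two steps apart are not consecutive on a cycle of length at least
      4.\<close>
    then show False using n m(1) j(1) j'(2) unfolding a_def b_def by (auto split: if_splits)
  qed
  ultimately show "has_chord E xs"
    using an(1) bn(1) unfolding has_chord_def n_def
    by (intro bexI[of _ "{xs ! a, xs ! b}"]) auto
qed

text \<open>An inclusion-minimal triangulation among those inside the finite \<open>H\<close> is
  minimal outright, as every triangulation contained in it is again inside \<open>H\<close>.\<close>

lemma minimal_triangulation_below:
  assumes "triangulation V E H"
  obtains F where "minimal_triangulation V E F" "F \<subseteq> H"
proof -
  define T where "T = {F. triangulation V E F \<and> F \<subseteq> H}"
  have "finite H"
    using assms unfolding triangulation_def chordal_def simple_graph_def
    by (meson finite_imp_finite_nsets finite_subset)
  then have "finite T" unfolding T_def by simp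
  moreover have "H \<in> T" using assms by (simp add: T_def)
  ultimately obtain F where F: "F \<in> T" "\<forall>F'\<in>T. F' \<subseteq> F \<longrightarrow> F = F'"
    using finite_has_minimal2[of T H] by metis
  have "minimal_triangulation V E F"
    using F unfolding minimal_triangulation_def T_def by blast
  then show ?thesis using that F(1) unfolding T_def by blast
qed

text \<open>Serves small \<open>k\<close>, where three colours cannot all be used. The complete
  graph is a triangulation, and a minimal one below it has a maximal clique by finiteness.\<close>

lemma pmc_exists:
  assumes "simple_graph V E"
  shows "\<exists>K. pmc V E K"
proof -
  have "chordal V ([V]\<^bsup>2\<^esup>)"
    using assms
    by (intro chordal_if_simplicial_outside_clique[where K = V])
       (auto simp: simple_graph_def clique_def nsets_def)
  then have "triangulation V E ([V]\<^bsup>2\<^esup>)"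
    using assms by (simp add: triangulation_def simple_graph_def)
  then obtain F where F: "minimal_triangulation V E F"
    using minimal_triangulation_below by blast
  define T where "T = {K. K \<subseteq> V \<and> clique K F}"
  have "finite T" using assms by (simp add: T_def simple_graph_def)
  moreover have "{} \<in> T" by (simp add: T_def clique_def)
  ultimately obtain K where "K \<in> T" "\<forall>K'\<in>T. K \<subseteq> K' \<longrightarrow> K = K'"
    using finite_has_maximal2[of T "{}"] by metis
  then have "maximal_clique V F K" unfolding maximal_clique_def T_def by blast
  with F show ?thesis unfolding pmc_def by blast
qed

section \<open>Cliques from colourings\<close>

definition support :: "nat + nat set \<Rightarrow> nat set" where
  "support v = (case v of Inl i \<Rightarrow> {i} | Inr p \<Rightarrow> p)"

lemma support_simps [simp]: "support (Inl i) = {i}" "support (Inr p) = p"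
  by (simp_all add: support_def)

text \<open>Colour 0 stands for being uncoloured and is discarded.\<close>

definition colours :: "(nat \<Rightarrow> nat) \<Rightarrow> nat + nat set \<Rightarrow> nat set" where
  "colours f v = f ` support v - {0}"

definition uncoloured :: "nat \<Rightarrow> (nat \<Rightarrow> nat) \<Rightarrow> (nat + nat set) set" where
  "uncoloured k f = Inl ` {i \<in> {1..k}. f i = 0}"

text \<open>A vertex of \<open>[k]\<close> has at most one colour, so two colours occur only at
  pairs whose ends have different nonzero colours.\<close>

definition crossing_clique :: "nat \<Rightarrow> (nat \<Rightarrow> nat) \<Rightarrow> (nat + nat set) set" where
  "crossing_clique k f = uncoloured k f \<union> {v \<in> G_verts k. card (colours f v) = 2}"

section \<open>The triangulation given by a colouring\<close>

locale three_colouring =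
  fixes k :: nat and f :: "nat \<Rightarrow> nat"
  assumes colour_le: "i \<in> {1..k} \<Longrightarrow> f i \<le> 3"
    and colour_used: "a \<in> {1, 2, 3} \<Longrightarrow> \<exists>i\<in>{1..k}. f i = a"
begin

abbreviation "V \<equiv> G_verts k"
abbreviation "Z \<equiv> uncoloured k f"
abbreviation "K \<equiv> crossing_clique k f"
abbreviation "col \<equiv> colours f"

text \<open>The bags of a star-shaped tree decomposition with centre \<open>K\<close>. Its leaves
  are the component of each nonzero colour with its neighbourhood, and each uncoloured pair with its
  ends.\<close>

definition bags :: "(nat + nat set) set set" where
  "bags = insert K ((\<lambda>a. Z \<union> {v \<in> V. a \<in> col v}) ` {1, 2, 3} \<union>
     {insert (Inr p) (Inl ` p) | p. p \<in> [{1..k}]\<^bsup>2\<^esup> \<and> col (Inr p) = {}})"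

definition H :: "(nat + nat set) set set" where
  "H = {e \<in> [V]\<^bsup>2\<^esup>. \<exists>b\<in>bags. e \<subseteq> b}"

text \<open>For one colour \<open>a\<close>, this is the component of colour \<open>a\<close> left
  by deleting \<open>K\<close>; for two colours it also includes the pairs in \<open>K\<close> that
  join them.\<close>

definition region :: "nat set \<Rightarrow> (nat + nat set) set" where
  "region X = {v \<in> V. col v \<noteq> {} \<and> col v \<subseteq> X}"

lemma Inl_in_V [simp]: "Inl i \<in> V \<longleftrightarrow> i \<in> {1..k}"
  by (auto simp: G_verts_def)

lemma Inr_in_V [simp]: "Inr p \<in> V \<longleftrightarrow> p \<in> [{1..k}]\<^bsup>2\<^esup>"
  by (auto simp: G_verts_def)

lemma finite_V: "finite V"
  using simple_graph_G by (simp add: simple_graph_def)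

lemma pair_in_nsets: "i \<in> {1..k} \<Longrightarrow> j \<in> {1..k} \<Longrightarrow> i \<noteq> j \<Longrightarrow> {i, j} \<in> [{1..k}]\<^bsup>2\<^esup>"
  by (auto simp: nsets_def)

lemma col_subset: "v \<in> V \<Longrightarrow> col v \<subseteq> {1, 2, 3}"
proof
  fix a assume "v \<in> V" "a \<in> col v"
  then obtain i where "i \<in> {1..k}" "a = f i" "a \<noteq> 0"
    by (auto simp: G_verts_def colours_def nsets_def)
  then show "a \<in> {1, 2, 3}" using colour_le[of i] by auto
qed

lemma finite_col: "v \<in> V \<Longrightarrow> finite (col v)"
  using col_subset finite_subset by blast

lemma card_col_le: "v \<in> V \<Longrightarrow> card (col v) \<le> 2"
proof -
  assume "v \<in> V"
  then have "finite (support v) \<and> card (support v) \<le> 2"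
    by (auto simp: G_verts_def nsets_def)
  then show ?thesis unfolding colours_def
    by (meson card_Diff1_le card_image_le finite_imageI le_trans)
qed

lemma col_end: "col (Inr p) = {} \<Longrightarrow> i \<in> p \<Longrightarrow> col (Inl i) = {}"
  by (auto simp: colours_def)

lemma G_edge: "p \<in> [{1..k}]\<^bsup>2\<^esup> \<Longrightarrow> i \<in> p \<Longrightarrow> {Inr p, Inl i} \<in> G_edges k \<and> {Inl i, Inr p} \<in> G_edges k"
  unfolding G_edges_def by (auto simp: insert_commute)

lemma col_Z: "v \<in> Z \<Longrightarrow> col v = {}"
  by (auto simp: uncoloured_def colours_def)

lemma Z_subset: "Z \<subseteq> V"
  by (auto simp: uncoloured_def)

lemma K_subset: "K \<subseteq> V"
  using Z_subset by (auto simp: crossing_clique_def)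

lemma bag_subset: "b \<in> bags \<Longrightarrow> b \<subseteq> V"
  using Z_subset K_subset unfolding bags_def by (auto simp: nsets_def)

text \<open>The number of colours is 0, 1 or 2. Without colours, a vertex of \<open>[k]\<close> lies
  in \<open>Z\<close> and hence in \<open>K\<close>, which leaves the pairs with both ends
  uncoloured.\<close>

lemma vertex_cases:
  assumes "v \<in> V"
  obtains "v \<in> K" | a where "a \<in> {1, 2, 3}" "col v = {a}"
    | p where "v = Inr p" "p \<in> [{1..k}]\<^bsup>2\<^esup>" "col v = {}"
proof -
  consider "card (col v) = 0" | "card (col v) = 1" | "card (col v) = 2"
    using card_col_le[OF assms] by linarith
  then show ?thesis
  proof cases
    case 1
    then have e: "col v = {}" using finite_col[OF assms] by simp
    show ?thesis
    proof (cases v)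
      case (Inl i)
      then have "v \<in> K"
        using e assms by (auto simp: crossing_clique_def uncoloured_def colours_def)
      then show ?thesis using that by blast
    next
      case (Inr p)
      then show ?thesis using e assms that by simp
    qed
  next
    case 2
    then obtain a where "col v = {a}" by (meson card_1_singletonE)
    then show ?thesis using col_subset[OF assms] that by auto
  next
    case 3
    then show ?thesis using assms that by (simp add: crossing_clique_def)
  qed
qed

lemma K_col: "v \<in> K \<Longrightarrow> v \<in> Z \<or> card (col v) = 2"
  by (auto simp: crossing_clique_def)

text \<open>Vertices of \<open>K\<close> have no or two colours, and the bag of an uncoloured pair
  has no coloured vertex, so only the bags of the colours remain.\<close>

lemma bag_of_coloured:
  assumes "b \<in> bags" "v \<in> b" "col v = {a}"
  shows "b = Z \<union> {v \<in> V. a \<in> col v}"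
proof -
  have "v \<notin> K" using assms(3) K_col[of v] col_Z[of v] by auto
  moreover have "v \<notin> Z" using assms(3) col_Z by auto
  moreover have "v \<notin> insert (Inr p) (Inl ` p)" if "col (Inr p) = {}" for p
    using that assms(3) col_end[OF that] by auto
  ultimately consider c where "b = Z \<union> {v \<in> V. c \<in> col v}"
    using assms(1,2) unfolding bags_def by blast
  then show ?thesis using assms(2,3) \<open>v \<notin> Z\<close> by cases auto
qed

lemma bag_of_uncoloured_pair:
  assumes "b \<in> bags" "Inr p \<in> b" "col (Inr p) = {}"
  shows "b = insert (Inr p) (Inl ` p)"
proof -
  have "Inr p \<notin> Z" by (auto simp: uncoloured_def)
  then show ?thesis using assms K_col[of "Inr p"] unfolding bags_def by auto
qed

lemma H_iff: "{x, y} \<in> H \<longleftrightarrow> x \<noteq> y \<and> (\<exists>b\<in>bags. x \<in> b \<and> y \<in> b)"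
proof -
  have "{x, y} \<in> [V]\<^bsup>2\<^esup> \<longleftrightarrow> x \<in> V \<and> y \<in> V \<and> x \<noteq> y"
    by (auto simp: nsets_def card_insert_if)
  then show ?thesis using bag_subset unfolding H_def by blast
qed

lemma bag_clique: "b \<in> bags \<Longrightarrow> clique b H"
  unfolding clique_def using H_iff by blast

lemma bag_unique:
  assumes "v \<in> V" "v \<notin> K" "b \<in> bags" "b' \<in> bags" "v \<in> b" "v \<in> b'"
  shows "b = b'"
  using assms(1)
proof (cases rule: vertex_cases)
  case (2 a)
  then show ?thesis
    using bag_of_coloured[OF assms(3,5)] bag_of_coloured[OF assms(4,6)] by blast
next
  case (3 p)
  then have p: "Inr p \<in> b" "Inr p \<in> b'" "col (Inr p) = {}" using assms(5,6) by simp_all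
  show ?thesis
    using bag_of_uncoloured_pair[OF assms(3) p(1,3)] bag_of_uncoloured_pair[OF assms(4) p(2,3)]
    by simp
qed (use assms(2) in blast)

text \<open>By \<open>bag_unique\<close> a vertex outside \<open>K\<close> lies in at most one bag,
  so its neighbours in \<open>H\<close> all lie in that clique.\<close>

lemma chordal_H: "chordal V H"
proof (rule chordal_if_simplicial_outside_clique)
  show "simple_graph V H" using finite_V by (auto simp: simple_graph_def H_def)
  show "clique K H" by (rule bag_clique) (simp add: bags_def)
  fix x assume x: "x \<in> V" "x \<notin> K"
  show "clique {y. {x, y} \<in> H} H"
    unfolding clique_def
  proof (intro ballI impI)
    fix y z assume yz: "y \<in> {y. {x, y} \<in> H}" "z \<in> {y. {x, y} \<in> H}" "y \<noteq> z"
    then obtain b b' where "b \<in> bags" "x \<in> b" "y \<in> b" "b' \<in> bags" "x \<in> b'" "z \<in> b'"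
      unfolding mem_Collect_eq H_iff by blast
    then have "b \<in> bags" "y \<in> b" "z \<in> b" using bag_unique[OF x, of b b'] by simp_all
    then show "{y, z} \<in> H" using yz(3) unfolding H_iff by blast
  qed
qed

lemma G_subset_H: "G_edges k \<subseteq> H"
proof
  fix e assume "e \<in> G_edges k"
  then obtain p i where e: "e = {Inr p, Inl i}" and p: "p \<in> [{1..k}]\<^bsup>2\<^esup>" and i: "i \<in> p"
    by (auto simp: G_edges_def)
  have ik: "i \<in> {1..k}" using p i by (auto simp: nsets_def)
  have "\<exists>b\<in>bags. Inr p \<in> b \<and> Inl i \<in> b"
  proof (cases "col (Inr p) = {}")
    case True
    then show ?thesis using p i unfolding bags_def
      by (intro bexI[of _ "insert (Inr p) (Inl ` p)"]) auto
  next
    case False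
    \<comment> \<open>The bag of any colour contains \<open>Z\<close>, so for an uncoloured end
      \<open>i\<close> any colour of the pair will do; otherwise the colour of \<open>i\<close> is
      taken.\<close>
    define a where "a = (if f i = 0 then SOME a. a \<in> col (Inr p) else f i)"
    have a: "a \<in> col (Inr p)"
      using False i some_in_eq[of "col (Inr p)"] by (auto simp: a_def colours_def)
    moreover have "Inl i \<in> Z \<or> a \<in> col (Inl i)"
      using ik by (auto simp: a_def uncoloured_def colours_def)
    moreover have "a \<in> {1, 2, 3}" using a p col_subset[of "Inr p"] by auto
    ultimately show ?thesis using p ik unfolding bags_def
      by (intro bexI[of _ "Z \<union> {v \<in> V. a \<in> col v}"]) auto
  qed
  then show "e \<in> H" unfolding e H_iff by auto
qed

lemma triangulation_H: "triangulation V (G_edges k) H"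
  using chordal_H G_subset_H by (simp add: triangulation_def)

section \<open>Minimal separators and the clique \<open>K\<close>\<close>

lemma regions_separated:
  assumes "x \<in> region {a}" "y \<in> region ({1, 2, 3} - {a})"
  shows "{x, y} \<notin> H"
proof
  assume "{x, y} \<in> H"
  then obtain b where b: "b \<in> bags" "x \<in> b" "y \<in> b" unfolding H_iff by blast
  have "col x = {a}" using assms(1) by (auto simp: region_def)
  \<comment> \<open>The only bag containing \<open>x\<close> is that of colour \<open>a\<close>;
    every vertex in it lies in \<open>Z\<close> or carries \<open>a\<close>, and \<open>y\<close>
    does neither.\<close>
  then have "b = Z \<union> {v \<in> V. a \<in> col v}" using b bag_of_coloured by blast
  then show False using b(3) assms(2) col_Z[of y] by (auto simp: region_def)
qed

lemma crossing_vertex_exists: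
  assumes "a \<in> {1, 2, 3}" "b \<in> {1, 2, 3}" "a \<noteq> b"
  obtains v where "v \<in> K" "col v = {a, b}"
proof -
  obtain i j where ij: "i \<in> {1..k}" "j \<in> {1..k}" "f i = a" "f j = b"
    using colour_used assms by metis
  have c: "col (Inr {i, j}) = {a, b}" using ij assms by (auto simp: colours_def)
  have "Inr {i, j} \<in> V" using ij assms(3) pair_in_nsets[of i j] by (metis Inr_in_V)
  with c have "Inr {i, j} \<in> K" using assms(3) by (simp add: crossing_clique_def)
  then show ?thesis using that c by blast
qed

text \<open>This yields the maximality of \<open>K\<close>: a vertex of colour \<open>a\<close>
  misses the pairs that join the other two colours, and an uncoloured pair misses every coloured
  vertex.\<close>

lemma nonneighbour_in_K:
  assumes "x \<in> V" "x \<notin> K"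
  shows "\<exists>y\<in>K. {x, y} \<notin> H"
  using assms(1)
proof (cases rule: vertex_cases)
  case (2 a)
  have "\<exists>b\<in>{1, 2, 3}. \<exists>c\<in>{1, 2, 3}. b \<noteq> c \<and> b \<noteq> a \<and> c \<noteq> a"
    using 2(1) by auto
  then obtain b c where bc: "b \<in> {1, 2, 3}" "c \<in> {1, 2, 3}" "b \<noteq> c" "b \<noteq> a" "c \<noteq> a"
    by blast
  obtain y where y: "y \<in> K" "col y = {b, c}" using crossing_vertex_exists[OF bc(1-3)] .
  have "{x, y} \<notin> H"
    using regions_separated[of x a y] 2 y bc assms(1) K_subset by (auto simp: region_def)
  with y show ?thesis by blast
next
  case (3 p)
  obtain y where y: "y \<in> K" "col y = {1, 2}" using crossing_vertex_exists[of 1 2] by auto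
  have "y \<notin> insert (Inr p) (Inl ` p)"
    using 3 y(2) col_end[of p] by auto
  then have "{x, y} \<notin> H"
    unfolding H_iff using bag_of_uncoloured_pair 3 by blast
  with y show ?thesis by blast
qed (use assms in blast)

text \<open>An uncoloured \<open>s\<close> enters through the pair \<open>{s, i}\<close>, whose only
  colour is that of \<open>i\<close>; a pair with a colour in \<open>X\<close> is adjacent to an end
  of that colour.\<close>

lemma walk_into_region:
  assumes X: "X \<subseteq> {1, 2, 3}" "X \<noteq> {}" and u: "u \<in> K" "u \<in> Z \<or> col u \<inter> X \<noteq> {}"
  obtains i w where "i \<in> {1..k}" "f i \<in> X" "walk (G_edges k) (insert u (region X)) u (Inl i) w"
proof (cases "u \<in> Z")
  case True
  then obtain s where s: "u = Inl s" "s \<in> {1..k}" "f s = 0" by (auto simp: uncoloured_def)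
  obtain i where i: "i \<in> {1..k}" "f i \<in> X" using X colour_used by (metis all_not_in_conv subsetD)
  have fi: "f i \<noteq> 0" using i X by auto
  then have p: "{s, i} \<in> [{1..k}]\<^bsup>2\<^esup>" using pair_in_nsets[of s i] s i by metis
  have "walk (G_edges k) (insert u (region X)) u (Inl i) [u, Inr {s, i}, Inl i]"
    using s i p fi G_edge[OF p, of s] G_edge[OF p, of i]
    by (simp add: walk_def region_def colours_def)
  then show ?thesis using that i by blast
next
  case False
  then obtain a where a: "a \<in> col u" "a \<in> X" using u by blast
  have cu: "card (col u) = 2" using False u(1) K_col by blast
  obtain p where p: "u = Inr p"
  proof (cases u)
    case (Inl i)
    then have "card (col u) \<le> 1"
      using card_Diff1_le[of "{f i}" 0] by (simp add: colours_def)
    then show ?thesis using cu by simp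
  qed
  then obtain i where i: "i \<in> p" "f i = a" "a \<noteq> 0" using a by (auto simp: colours_def)
  have pV: "p \<in> [{1..k}]\<^bsup>2\<^esup>" using u(1) K_subset p by auto
  then have ik: "i \<in> {1..k}" using i by (auto simp: nsets_def)
  have "walk (G_edges k) (insert u (region X)) u (Inl i) [u, Inl i]"
    using p i ik a G_edge[OF pV i(1)] by (simp add: walk_def region_def colours_def)
  then show ?thesis using that ik i a by blast
qed

text \<open>The pair \<open>{i, j}\<close> links its two ends, and its colours are theirs, so it
  stays in the region.\<close>

lemma walk_within_region:
  assumes "i \<in> {1..k}" "j \<in> {1..k}" "f i \<in> X" "f j \<in> X" "0 \<notin> X"
  obtains w where "walk (G_edges k) (region X) (Inl i) (Inl j) w"
proof (cases "i = j")
  case True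
  have "f i \<noteq> 0" using assms by metis
  with True have "walk (G_edges k) (region X) (Inl i) (Inl j) [Inl i]"
    using assms by (auto simp: walk_def region_def colours_def)
  then show ?thesis using that by blast
next
  case False
  have nz: "f i \<noteq> 0" "f j \<noteq> 0" using assms by metis+
  from False have p: "{i, j} \<in> [{1..k}]\<^bsup>2\<^esup>" using pair_in_nsets[of i j] assms by metis
  have "walk (G_edges k) (region X) (Inl i) (Inl j) [Inl i, Inr {i, j}, Inl j]"
    using assms p nz G_edge[OF p, of i] G_edge[OF p, of j]
    by (simp add: walk_def region_def colours_def)
  then show ?thesis using that by blast
qed

lemma walk_through_region:
  assumes X: "X \<subseteq> {1, 2, 3}" "X \<noteq> {}"
    and u: "u \<in> K" "u \<in> Z \<or> col u \<inter> X \<noteq> {}" and v: "v \<in> K" "v \<in> Z \<or> col v \<inter> X \<noteq> {}"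
  obtains w where "walk (G_edges k) (insert u (insert v (region X))) u v w"
proof -
  let ?U = "insert u (insert v (region X))"
  obtain i w1 where i: "i \<in> {1..k}" "f i \<in> X" "walk (G_edges k) (insert u (region X)) u (Inl i) w1"
    using walk_into_region[OF X u] .
  obtain j w2 where j: "j \<in> {1..k}" "f j \<in> X" "walk (G_edges k) (insert v (region X)) v (Inl j) w2"
    using walk_into_region[OF X v] .
  have "0 \<notin> X" using X by auto
  then obtain w3 where w3: "walk (G_edges k) (region X) (Inl i) (Inl j) w3"
    using walk_within_region[of i j X] i j by blast
  have "walk (G_edges k) ?U u (Inl i) w1" "walk (G_edges k) ?U (Inl i) (Inl j) w3"
    "walk (G_edges k) ?U (Inl j) v (rev w2)"
    using i(3) w3 walk_rev[OF j(3)] by (auto simp: walk_def)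
  then show ?thesis using that[OF walk_trans[OF walk_trans]] by blast
qed

lemma K_common_colour:
  assumes "u \<in> K" "v \<in> K"
  obtains a where "a \<in> {1, 2, 3}" "u \<in> Z \<or> a \<in> col u" "v \<in> Z \<or> a \<in> col v"
proof -
  have V: "u \<in> V" "v \<in> V" using assms K_subset by auto
  have "\<exists>a\<in>{1, 2, 3}. (u \<in> Z \<or> a \<in> col u) \<and> (v \<in> Z \<or> a \<in> col v)"
  proof (rule ccontr)
    assume neg: "\<not> ?thesis"
    \<comment> \<open>If one of the two were in \<open>Z\<close>, any colour of the other would be
      common, and any colour at all if both were.\<close>
    have nZ: "u \<notin> Z" "v \<notin> Z"
      using neg col_subset[OF V(1)] col_subset[OF V(2)] K_col[OF assms(1)] K_col[OF assms(2)]
      by (fastforce simp: card_2_iff)+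
    then have c: "card (col u) = 2" "card (col v) = 2" using K_col assms by blast+
    \<comment> \<open>Two disjoint sets of two colours would need four colours.\<close>
    have "col u \<inter> col v = {}" using neg col_subset[OF V(1)] by blast
    then have "card (col u \<union> col v) = 4"
      using c finite_col V by (simp add: card_Un_disjoint)
    moreover have "card (col u \<union> col v) \<le> card {1, 2, 3 :: nat}"
      using col_subset V by (intro card_mono) auto
    ultimately show False by simp
  qed
  then show ?thesis using that by blast
qed

text \<open>Both \<open>region {a}\<close> and \<open>region ({1, 2, 3} - {a})\<close> are full components for the part of \<open>K\<close>
  consisting of the uncoloured vertices and the pairs with colour \<open>a\<close>.\<close>

lemma clique_K:
  assumes F: "chordal V F" "G_edges k \<subseteq> F" "F \<subseteq> H"
  shows "clique K F"
  unfolding clique_def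
proof (intro ballI impI)
  fix u v assume uv: "u \<in> K" "v \<in> K" "u \<noteq> v"
  obtain a where a: "a \<in> {1, 2, 3}" "u \<in> Z \<or> a \<in> col u" "v \<in> Z \<or> a \<in> col v"
    using K_common_colour uv by blast
  let ?X = "{1, 2, 3} - {a}"
  \<comment> \<open>A vertex of \<open>K\<close> outside \<open>Z\<close> has two colours, hence one
    other than \<open>a\<close>; this lets walks enter the second region.\<close>
  have meets: "x \<in> Z \<or> col x \<inter> ?X \<noteq> {}" if "x \<in> K" for x
  proof (rule ccontr)
    assume neg: "\<not> ?thesis"
    then have "col x \<subseteq> {a}" using col_subset[of x] that K_subset by blast
    then have "card (col x) \<le> 1" using card_mono[of "{a}" "col x"] by simp
    then show False using neg K_col[OF that] by auto
  qed
  \<comment> \<open>Vertices of the separator are uncoloured or have \<open>a\<close> and a further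
    colour.\<close>
  have outside: "x \<notin> region {a} \<union> region ?X" if "x \<in> K" "x \<in> Z \<or> a \<in> col x" for x
    using that meets[of x] col_Z[of x] by (auto simp: region_def)
  have "?X \<noteq> {}" using a(1) by auto
  then obtain w w' where
    "walk (G_edges k) (insert u (insert v (region {a}))) u v w"
    "walk (G_edges k) (insert v (insert u (region ?X))) v u w'"
    using walk_through_region[of "{a}" u v] walk_through_region[of ?X v u] a uv meets
    by (metis Diff_subset Int_insert_right_if1 empty_subsetI insert_not_empty insert_subset)
  then have w: "walk F (insert u (insert v (region {a}))) u v w"
    and w': "walk F (insert u (insert v (region ?X))) v u w'"
    using walk_mono F(2) by (auto simp: insert_commute)
  show "{u, v} \<in> F"
  proof (rule chordal_edge_if_separated[OF F(1) uv(3) _ _ _ w w'])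
    show "u \<notin> region {a} \<union> region ?X" "v \<notin> region {a} \<union> region ?X"
      using outside uv a by blast+
    show "region {a} \<inter> region ?X = {}" by (auto simp: region_def)
    show "{x, y} \<notin> F" if "x \<in> region {a}" "y \<in> region ?X" for x y
      using regions_separated[OF that] F(3) by blast
  qed
qed

text \<open>In a minimal triangulation inside \<open>H\<close>, \<open>K\<close> is a clique by
  \<open>clique_K\<close>, and non-neighbours in \<open>H\<close> stay non-neighbours, which gives
  maximality.\<close>

lemma pmc_K: "pmc V (G_edges k) K"
proof -
  obtain F where F: "minimal_triangulation V (G_edges k) F" "F \<subseteq> H"
    using minimal_triangulation_below[OF triangulation_H] .
  have "clique K F"
    using F by (intro clique_K) (auto simp: minimal_triangulation_def triangulation_def)
  moreover have "\<not> clique K' F" if K': "K' \<subseteq> V" "K \<subset> K'" for K'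
  proof
    assume cl: "clique K' F"
    obtain x where x: "x \<in> K'" "x \<notin> K" using K' by blast
    then obtain y where y: "y \<in> K" "{x, y} \<notin> H" using nonneighbour_in_K[of x] K'(1) by blast
    then have "{x, y} \<in> F" using cl x K'(2) unfolding clique_def by (metis psubsetD)
    then show False using y(2) F(2) by blast
  qed
  ultimately have "maximal_clique V F K"
    using K_subset unfolding maximal_clique_def by blast
  with F show ?thesis unfolding pmc_def by blast
qed

end

section \<open>Counting the colourings\<close>

lemma card_pmc_ge:
  assumes k: "k \<ge> 3"
  shows "card {K. pmc (G_verts k) (G_edges k) K} \<ge> 4 ^ (k - 3)"
proof -
  \<comment> \<open>Fixing the colours of 1, 2 and 3 makes all three colours occur; the other
    \<open>k - 3\<close> elements are free, with four choices each.\<close>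
  define ext :: "(nat \<Rightarrow> nat) \<Rightarrow> nat \<Rightarrow> nat" where "ext g i = (if i \<le> 3 then i else g i)" for g i
  define \<G> :: "(nat \<Rightarrow> nat) set" where "\<G> = {4..k} \<rightarrow>\<^sub>E {0..3}"
  have tc: "three_colouring k (ext g)" if "g \<in> \<G>" for g
  proof
    fix i assume "i \<in> {1..k}"
    then show "ext g i \<le> 3"
      using PiE_mem[of g "{4..k}" "\<lambda>_. {0..3}" i] that by (auto simp: ext_def \<G>_def)
  next
    fix a :: nat assume "a \<in> {1, 2, 3}"
    then show "\<exists>i\<in>{1..k}. ext g i = a"
      using k by (intro bexI[of _ a]) (auto simp: ext_def)
  qed
  \<comment> \<open>Membership of \<open>i\<close> in the clique tells whether its colour is 0.
    Otherwise its colour is the only \<open>a\<close> among 1, 2, 3 for which the pair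
    \<open>{i, a}\<close> is not crossing, as \<open>a\<close> itself has colour
    \<open>a\<close>.\<close>
  have recover: "g i = (if Inl i \<in> crossing_clique k (ext g) then 0
      else THE a. a \<in> {1, 2, 3} \<and> Inr {i, a} \<notin> crossing_clique k (ext g))"
    if g: "g \<in> \<G>" and i: "i \<in> {4..k}" for g i
  proof -
    interpret three_colouring k "ext g" by (rule tc[OF g])
    have ext: "ext g i = g i" using i by (simp add: ext_def)
    have le: "g i \<le> 3" using colour_le[of i] i ext by auto
    have "card (colours (ext g) (Inl i)) \<le> 1"
      using card_Diff1_le[of "{g i}" 0] by (simp add: colours_def ext)
    then have zero: "Inl i \<in> K \<longleftrightarrow> g i = 0"
      using i ext by (auto simp: crossing_clique_def uncoloured_def)
    have cross: "Inr {i, a} \<notin> K \<longleftrightarrow> a = g i" if "g i \<noteq> 0" "a \<in> {1, 2, 3}" for a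
    proof -
      have a: "ext g a = a" "a \<in> {1..k}" "i \<in> {1..k}" "i \<noteq> a" "a \<noteq> 0"
        using that i k by (auto simp: ext_def)
      then have "colours (ext g) (Inr {i, a}) = {g i, a}"
        using that(1) ext by (auto simp: colours_def)
      moreover have "Inr {i, a} \<in> G_verts k" using pair_in_nsets[OF a(3,2,4)] by simp
      ultimately show ?thesis
        by (auto simp: crossing_clique_def uncoloured_def card_insert_if)
    qed
    show ?thesis
    proof (cases "g i = 0")
      case False
      have "(THE a. a \<in> {1, 2, 3} \<and> Inr {i, a} \<notin> K) = g i"
      proof (rule the_equality)
        have "g i \<in> {1, 2, 3}" using le False by auto
        then show "g i \<in> {1, 2, 3} \<and> Inr {i, g i} \<notin> K" using cross[OF False] by blast
      qed (use cross[OF False] in blast)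
      then show ?thesis using zero False by simp
    qed (simp add: zero)
  qed
  have "inj_on (\<lambda>g. crossing_clique k (ext g)) \<G>"
  proof (rule inj_onI)
    fix g h assume gh: "g \<in> \<G>" "h \<in> \<G>" "crossing_clique k (ext g) = crossing_clique k (ext h)"
    show "g = h"
    proof (rule PiE_ext[OF gh(1,2)[unfolded \<G>_def]])
      show "g i = h i" if "i \<in> {4..k}" for i
        by (simp only: recover[OF gh(1) that] recover[OF gh(2) that] gh(3))
    qed
  qed
  moreover have "(\<lambda>g. crossing_clique k (ext g)) ` \<G> \<subseteq> {K. pmc (G_verts k) (G_edges k) K}"
    using three_colouring.pmc_K[OF tc] by auto
  moreover have "finite {K. pmc (G_verts k) (G_edges k) K}"
    using simple_graph_G by (intro finite_pmcs) (simp add: simple_graph_def)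
  ultimately have "card \<G> \<le> card {K. pmc (G_verts k) (G_edges k) K}"
    by (rule card_inj_on_le)
  moreover have "card \<G> = 4 ^ (k - 3)" by (simp add: \<G>_def card_PiE)
  ultimately show ?thesis by simp
qed

theorem theorem12:
  shows "\<exists>c::real. c > 0 \<and>
    (\<forall>k::nat. k \<ge> 1 \<longrightarrow> real (card {K. pmc (G_verts k) (G_edges k) K}) \<ge> c * 4 ^ k)"
proof (intro exI[of _ "1 / 64"] conjI allI impI)
  fix k :: nat
  let ?P = "{K. pmc (G_verts k) (G_edges k) K}"
  \<comment> \<open>The factor 1/64 pays for the three fixed elements. For \<open>k < 3\<close> the
    bound is at most 1, so one potential maximal clique is enough.\<close>
  show "real (card ?P) \<ge> 1 / 64 * 4 ^ k"
  proof (cases "k \<ge> 3")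
    case True
    then have "1 / 64 * (4::real) ^ k = 4 ^ (k - 3)"
      by (simp add: power_diff)
    also have "\<dots> = real (4 ^ (k - 3))" by simp
    also have "\<dots> \<le> real (card ?P)" using card_pmc_ge[OF True] by (simp only: of_nat_le_iff)
    finally show ?thesis .
  next
    case False
    have "?P \<noteq> {}" using pmc_exists[OF simple_graph_G] by blast
    moreover have "finite ?P"
      using simple_graph_G by (intro finite_pmcs) (simp add: simple_graph_def)
    ultimately have "card ?P \<ge> 1" by (simp add: Suc_le_eq card_gt_0_iff)
    moreover have "(4::real) ^ k \<le> 4 ^ 3" using False by (intro power_increasing) auto
    ultimately show ?thesis by simp
  qed
qed simp

end
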